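(* Let $G$ be a non-complete chordal graph of order $n$ with clique number $d$, let $K_d=\{x_1,\ldots,x_d\}$ be a maximum clique, let $\sigma$ be an admissible PEO for $(G,K_d)$, and let $T=\alpha_\sigma(G)$. Then $T$ is a threshold graph, and $G$ and $T$ have the same clique vector and the same $b$--vector.
   Context: Graphs are finite and simple; chordal means every cycle of length at least $4$ has a chord. A PEO (perfect elimination ordering) is a bijection $\sigma:\{1,\ldots,n\}\to V(G)$ such that each $\sigma(i)$ is simplicial (its neighbourhood is a clique) in the subgraph induced by $\{\sigma(i),\ldots,\sigma(n)\}$. $N_\sigma(v)=\{u\in N(v):\sigma^{-1}(v)<\sigma^{-1}(u)\}$, $n_\sigma(v)=|N_\sigma(v)|$, and for a maximal clique $C$, $s(C)=\{x\in C:N_\sigma(x)\not\subseteq C\}$. A PEO $\sigma$ is admissible for $(G,K_d)$ if: (a) every vertex outside $K_d$ precedes every vertex of $K_d$ and $\sigma^{-1}(x_i)=n-i+1$ for $i=1,\ldots,d$; and for every maximal clique $C$: (b) $\sigma^{-1}(u)<\sigma^{-1}(v)$ for all $u\in C\setminus s(C)$, $v\in s(C)$; (c) if $|s(C)|<i\le|C|$ there is a unique $u\in C\setminus s(C)$ with $n_\sigma(u)=i-1$; (d) for every other maximal clique $C'$ with $C\cap C'\ne\emptyset$, either all of $C\setminus C'$ or all of $C'\setminus C$ precede all of $C\cap C'$ in $\sigma$. The graph $\alpha_\sigma(G)$ has vertex set $V(G)$ and edge set $\alpha_\sigma(E(G))$, where $\alpha_\sigma(uv)=uv$ for edges inside $K_d$,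 and for $u\notin K_d$ with $N_\sigma(u)=\{u_1,\ldots,u_{n_\sigma(u)}\}$ listed so that $\sigma^{-1}(u_1)<\cdots<\sigma^{-1}(u_{n_\sigma(u)})$, $\alpha_\sigma(uu_i)=ux_i$. A threshold graph is one obtainable from a single vertex by repeatedly adding an isolated vertex or a vertex adjacent to all existing vertices. The clique vector is $(c_1,\ldots,c_d)$ with $c_i$ the number of cliques with $i$ vertices, and the $b$--vector $(b_1,\ldots,b_d)$ is defined by $\sum_i b_i(x+1)^{i-1}=\sum_i c_ix^{i-1}$. *)

theory Defs
  imports Complex_Main "HOL-Library.Ramsey" "HOL-Computational_Algebra.Polynomial"
begin

text \<open>
  A graph is a vertex set \<open>V\<close> together with a set \<open>E\<close> of two-element subsets of \<open>V\<close>.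
  The predicate \<open>clique C E\<close> (pairwise adjacency) is the one of \<^theory>\<open>HOL-Library.Ramsey\<close>.
\<close>

definition simple_graph :: "'a set \<Rightarrow> 'a set set \<Rightarrow> bool" where
  "simple_graph V E \<longleftrightarrow> finite V \<and> E \<subseteq> [V]\<^bsup>2\<^esup>"

definition complete_graph :: "'a set \<Rightarrow> 'a set set \<Rightarrow> bool" where
  "complete_graph V E \<longleftrightarrow> E = [V]\<^bsup>2\<^esup>"

definition neighbours :: "'a set set \<Rightarrow> 'a \<Rightarrow> 'a set" where
  "neighbours E v = {u. {v, u} \<in> E}"

definition induced_edges :: "'a set set \<Rightarrow> 'a set \<Rightarrow> 'a set set" where
  "induced_edges E W = {e \<in> E. e \<subseteq> W}"

definition cliques :: "'a set \<Rightarrow> 'a set set \<Rightarrow> 'a set set" where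
  "cliques V E = {C. C \<subseteq> V \<and> clique C E}"

definition maximal_clique :: "'a set \<Rightarrow> 'a set set \<Rightarrow> 'a set \<Rightarrow> bool" where
  "maximal_clique V E C \<longleftrightarrow> C \<in> cliques V E \<and> (\<forall>C' \<in> cliques V E. C \<subseteq> C' \<longrightarrow> C' = C)"

definition clique_number :: "'a set \<Rightarrow> 'a set set \<Rightarrow> nat" where
  "clique_number V E = Max (card ` cliques V E)"

definition maximum_clique :: "'a set \<Rightarrow> 'a set set \<Rightarrow> 'a set \<Rightarrow> bool" where
  "maximum_clique V E C \<longleftrightarrow> C \<in> cliques V E \<and> card C = clique_number V E"


text \<open>A cycle is given by the list of its vertices; the last vertex is joined to the first.\<close>

definition cycle_edges :: "'a list \<Rightarrow> 'a set set" where
  "cycle_edges p = {{p ! i, p ! (Suc i mod length p)} | i. i < length p}"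

definition is_cycle :: "'a set \<Rightarrow> 'a set set \<Rightarrow> 'a list \<Rightarrow> bool" where
  "is_cycle V E p \<longleftrightarrow> 3 \<le> length p \<and> distinct p \<and> set p \<subseteq> V \<and> cycle_edges p \<subseteq> E"

definition has_chord :: "'a set set \<Rightarrow> 'a list \<Rightarrow> bool" where
  "has_chord E p \<longleftrightarrow> (\<exists>e \<in> E. e \<subseteq> set p \<and> e \<notin> cycle_edges p)"

definition chordal :: "'a set \<Rightarrow> 'a set set \<Rightarrow> bool" where
  "chordal V E \<longleftrightarrow> (\<forall>p. is_cycle V E p \<and> 4 \<le> length p \<longrightarrow> has_chord E p)"


definition simplicial :: "'a set set \<Rightarrow> 'a \<Rightarrow> bool" where
  "simplicial E v \<longleftrightarrow> clique (neighbours E v) E"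

definition PEO :: "'a set \<Rightarrow> 'a set set \<Rightarrow> (nat \<Rightarrow> 'a) \<Rightarrow> bool" where
  "PEO V E \<sigma> \<longleftrightarrow> bij_betw \<sigma> {1..card V} V \<and>
     (\<forall>i \<in> {1..card V}. simplicial (induced_edges E (\<sigma> ` {i..card V})) (\<sigma> i))"

text \<open>\<open>pos V \<sigma>\<close> is the inverse bijection of an ordering \<open>\<sigma>\<close>.\<close>

definition pos :: "'a set \<Rightarrow> (nat \<Rightarrow> 'a) \<Rightarrow> 'a \<Rightarrow> nat" where
  "pos V \<sigma> = inv_into {1..card V} \<sigma>"

definition precedes :: "'a set \<Rightarrow> (nat \<Rightarrow> 'a) \<Rightarrow> 'a set \<Rightarrow> 'a set \<Rightarrow> bool" where
  "precedes V \<sigma> A B \<longleftrightarrow> (\<forall>u \<in> A. \<forall>v \<in> B. pos V \<sigma> u < pos V \<sigma> v)"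

definition later_nbrs :: "'a set \<Rightarrow> 'a set set \<Rightarrow> (nat \<Rightarrow> 'a) \<Rightarrow> 'a \<Rightarrow> 'a set" where
  "later_nbrs V E \<sigma> v = {u \<in> neighbours E v. pos V \<sigma> v < pos V \<sigma> u}"

definition later_deg :: "'a set \<Rightarrow> 'a set set \<Rightarrow> (nat \<Rightarrow> 'a) \<Rightarrow> 'a \<Rightarrow> nat" where
  "later_deg V E \<sigma> v = card (later_nbrs V E \<sigma> v)"

text \<open>The set \<open>s(C)\<close> of the vertices of \<open>C\<close> with a later neighbour outside \<open>C\<close>.\<close>

definition s_set :: "'a set \<Rightarrow> 'a set set \<Rightarrow> (nat \<Rightarrow> 'a) \<Rightarrow> 'a set \<Rightarrow> 'a set" where
  "s_set V E \<sigma> C = {v \<in> C. \<not> later_nbrs V E \<sigma> v \<subseteq> C}"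

text \<open>In the following, \<open>x\<close> enumerates the vertices of \<open>K\<close> as \<open>x 1, \<dots>, x (card K)\<close>.\<close>

definition admissible :: "'a set \<Rightarrow> 'a set set \<Rightarrow> 'a set \<Rightarrow> (nat \<Rightarrow> 'a) \<Rightarrow> (nat \<Rightarrow> 'a) \<Rightarrow> bool" where
  "admissible V E K x \<sigma> \<longleftrightarrow>
     PEO V E \<sigma> \<and>
     precedes V \<sigma> (V - K) K \<and>
     (\<forall>i \<in> {1..card K}. pos V \<sigma> (x i) = card V - i + 1) \<and>
     (\<forall>C. maximal_clique V E C \<longrightarrow>
        precedes V \<sigma> (C - s_set V E \<sigma> C) (s_set V E \<sigma> C) \<and>
        (\<forall>i. card (s_set V E \<sigma> C) < i \<and> i \<le> card C \<longrightarrow>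
           (\<exists>!u. u \<in> C - s_set V E \<sigma> C \<and> later_deg V E \<sigma> u = i - 1)) \<and>
        (\<forall>C'. maximal_clique V E C' \<and> C' \<noteq> C \<and> C \<inter> C' \<noteq> {} \<longrightarrow>
           precedes V \<sigma> (C - C') (C \<inter> C') \<or> precedes V \<sigma> (C' - C) (C \<inter> C')))"

text \<open>\<open>later_nth V E \<sigma> u i\<close> is the \<open>i\<close>-th element, counted from 1, of the list of
  the later neighbours of \<open>u\<close> in increasing order of position.\<close>

definition later_nth :: "'a set \<Rightarrow> 'a set set \<Rightarrow> (nat \<Rightarrow> 'a) \<Rightarrow> 'a \<Rightarrow> nat \<Rightarrow> 'a" where
  "later_nth V E \<sigma> u i = \<sigma> (sorted_list_of_set (pos V \<sigma> ` later_nbrs V E \<sigma> u) ! (i - 1))"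

text \<open>The description operator is justified by the lemmas \<open>ex_later_nth\<close> and \<open>alpha_edge_outside\<close>.\<close>

definition alpha_edge ::
  "'a set \<Rightarrow> 'a set set \<Rightarrow> 'a set \<Rightarrow> (nat \<Rightarrow> 'a) \<Rightarrow> (nat \<Rightarrow> 'a) \<Rightarrow> 'a set \<Rightarrow> 'a set" where
  "alpha_edge V E K x \<sigma> e =
     (if e \<subseteq> K then e
      else THE f. \<exists>u \<in> V - K. \<exists>i \<in> {1..later_deg V E \<sigma> u}.
             e = {u, later_nth V E \<sigma> u i} \<and> f = {u, x i})"

text \<open>The edge set of \<open>\<alpha>\<^sub>\<sigma>(G)\<close>; its vertex set is \<open>V\<close>.\<close>

definition alpha_edges ::
  "'a set \<Rightarrow> 'a set set \<Rightarrow> 'a set \<Rightarrow> (nat \<Rightarrow> 'a) \<Rightarrow> (nat \<Rightarrow> 'a) \<Rightarrow> 'a set set" where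
  "alpha_edges V E K x \<sigma> = alpha_edge V E K x \<sigma> ` E"


inductive threshold_graph :: "'a set \<Rightarrow> 'a set set \<Rightarrow> bool" where
  single: "threshold_graph {v} {}"
| isolated: "threshold_graph V E \<Longrightarrow> v \<notin> V \<Longrightarrow> threshold_graph (insert v V) E"
| dominating: "threshold_graph V E \<Longrightarrow> v \<notin> V \<Longrightarrow>
    threshold_graph (insert v V) (E \<union> {{v, u} | u. u \<in> V})"


text \<open>The lists below are indexed from 0, so that entry \<open>i\<close> of the list is the entry with
  index \<open>i + 1\<close> of the vector.\<close>

definition clique_vector :: "'a set \<Rightarrow> 'a set set \<Rightarrow> nat list" where
  "clique_vector V E = map (\<lambda>i. card {C \<in> cliques V E. card C = i}) [1..<Suc (clique_number V E)]"

text \<open>The defining identity is one of polynomials over the integers; \<open>[:1, 1:]\<close> is \<open>x + 1\<close>.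
  Existence and uniqueness is lemma \<open>b_vector_ex1\<close>.\<close>

definition b_vector :: "'a set \<Rightarrow> 'a set set \<Rightarrow> int list" where
  "b_vector V E = (THE b. length b = length (clique_vector V E) \<and>
     (\<Sum>i<length b. smult (b ! i) ([:1, 1:] ^ i)) =
     (\<Sum>i<length (clique_vector V E). monom (int (clique_vector V E ! i)) i))"


lemma b_vector_ex1:
  fixes c :: "nat list"
  shows "\<exists>!b :: int list. length b = length c \<and>
    (\<Sum>i<length b. smult (b ! i) ([:1, 1:] ^ i)) = (\<Sum>i<length c. monom (int (c ! i)) i)"
proof -
  let ?P = "\<Sum>i<length c. monom (int (c ! i)) i"
  have shift: "pcompose (pcompose p [:-1, 1:]) [:1, 1:] = p"
    "pcompose (pcompose p [:1, 1:]) [:-1, 1:] = p" for p :: "int poly"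
    by (simp_all add: pcompose_assoc[symmetric] pcompose_pCons)
  have mono: "monom a i = smult a ([:0, 1:] ^ i)" for a :: int and i
    by (simp add: monom_altdef)
  have pow: "pcompose (p ^ k) q = pcompose p q ^ k" for p q :: "int poly" and k
    by (induction k) (simp_all add: pcompose_1 pcompose_mult)
  have comp: "pcompose (\<Sum>i<n. monom (f i) i) [:1, 1:] = (\<Sum>i<n. smult (f i) ([:1, 1:] ^ i))"
    for f :: "nat \<Rightarrow> int" and n
    by (induction n) (simp_all add: pcompose_add mono pcompose_smult pow pcompose_pCons)
  have cf: "coeff (\<Sum>i<n. monom (f i) i) k = (if k < n then f k else 0)"
    for f :: "nat \<Rightarrow> int" and n k
    by (induction n) auto
  show ?thesis
  proof (rule ex_ex1I)
    let ?Q = "pcompose ?P [:-1, 1:]"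
    let ?b = "map (coeff ?Q) [0..<length c]"
    have dQ: "coeff ?Q k = 0" if "k \<ge> length c" for k
    proof (cases "length c = 0")
      case False
      have "degree ?P \<le> length c - 1"
        by (rule degree_le) (use cf[of "\<lambda>i. int (c ! i)" "length c"] False in auto)
      then have "degree ?P < k" using False that by linarith
      then have "degree ?Q < k" by (simp add: degree_pcompose)
      then show ?thesis by (rule coeff_eq_0)
    qed simp
    have "(\<Sum>i<length c. monom (coeff ?Q i) i) = ?Q"
      by (rule poly_eqI) (use cf dQ in auto)
    then have "(\<Sum>i<length c. smult (coeff ?Q i) ([:1, 1:] ^ i)) = ?P"
      using comp[of "coeff ?Q" "length c"] shift by simp
    then show "\<exists>b. length b = length c \<and> (\<Sum>i<length b. smult (b ! i) ([:1, 1:] ^ i)) = ?P"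
      by (intro exI[of _ ?b]) simp
  next
    fix b b' :: "int list"
    assume b: "length b = length c \<and> (\<Sum>i<length b. smult (b ! i) ([:1, 1:] ^ i)) = ?P"
      and b': "length b' = length c \<and> (\<Sum>i<length b'. smult (b' ! i) ([:1, 1:] ^ i)) = ?P"
    have "pcompose (\<Sum>i<length c. monom (b ! i) i) [:1, 1:] =
          pcompose (\<Sum>i<length c. monom (b' ! i) i) [:1, 1:]"
      using b b' unfolding comp by metis
    then have "(\<Sum>i<length c. monom (b ! i) i) = (\<Sum>i<length c. monom (b' ! i) i)"
      by (metis shift(2))
    then have "b ! k = b' ! k" if "k < length c" for k
      using cf[of "(!) b" "length c" k] cf[of "(!) b'" "length c" k] that by simp
    then show "b = b'" using b b' by (simp add: list_eq_iff_nth_eq)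
  qed
qed

lemma later_nbrs_finite:
  assumes "simple_graph V E"
  shows "finite (later_nbrs V E \<sigma> u)" "later_nbrs V E \<sigma> u \<subseteq> V"
proof -
  show "later_nbrs V E \<sigma> u \<subseteq> V"
    using assms unfolding later_nbrs_def neighbours_def simple_graph_def nsets_def by fastforce
  then show "finite (later_nbrs V E \<sigma> u)"
    using assms finite_subset unfolding simple_graph_def by blast
qed

lemma later_nth_bij:
  assumes "simple_graph V E" "bij_betw \<sigma> {1..card V} V"
  shows "bij_betw (later_nth V E \<sigma> u) {1..later_deg V E \<sigma> u} (later_nbrs V E \<sigma> u)"
proof -
  let ?N = "later_nbrs V E \<sigma> u"
  let ?l = "sorted_list_of_set (pos V \<sigma> ` ?N)"
  note N = later_nbrs_finite[OF assms(1), of \<sigma> u]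
  have inj: "inj_on (pos V \<sigma>) ?N"
    using N assms(2) unfolding pos_def bij_betw_def by (metis inj_on_inv_into)
  have len: "length ?l = later_deg V E \<sigma> u"
    using card_image[OF inj] by (simp add: later_deg_def)
  have "bij_betw (\<lambda>i. i - 1) {1..later_deg V E \<sigma> u} {..<later_deg V E \<sigma> u}"
    by (rule bij_betw_byWitness[where f' = Suc]) auto
  moreover have "bij_betw ((!) ?l) {..<later_deg V E \<sigma> u} (pos V \<sigma> ` ?N)"
    using N len by (intro bij_betw_nth) auto
  moreover have "bij_betw \<sigma> (pos V \<sigma> ` ?N) ?N"
    by (rule bij_betw_byWitness[where f' = "pos V \<sigma>"])
      (use N assms(2) in \<open>auto simp: pos_def bij_betw_def f_inv_into_f subset_iff\<close>)
  ultimately have "bij_betw (\<sigma> \<circ> ((!) ?l \<circ> (\<lambda>i. i - 1))) {1..later_deg V E \<sigma> u} ?N"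
    by (intro bij_betw_trans)
  then show ?thesis
    by (rule bij_betw_cong[THEN iffD1, rotated]) (simp add: later_nth_def)
qed

lemma ex_later_nth:
  assumes "simple_graph V E" "bij_betw \<sigma> {1..card V} V" "v \<in> later_nbrs V E \<sigma> u"
  shows "\<exists>i \<in> {1..later_deg V E \<sigma> u}. v = later_nth V E \<sigma> u i"
  using later_nth_bij[OF assms(1,2), of u] assms(3) unfolding bij_betw_def by blast

lemma alpha_edge_outside:
  assumes "simple_graph V E" "bij_betw \<sigma> {1..card V} V"
    and "u \<in> V - K" "i \<in> {1..later_deg V E \<sigma> u}"
  shows "alpha_edge V E K x \<sigma> {u, later_nth V E \<sigma> u i} = {u, x i}"
proof -
  note bij = later_nth_bij[OF assms(1,2)]
  have lt: "pos V \<sigma> w < pos V \<sigma> (later_nth V E \<sigma> w j)" if "j \<in> {1..later_deg V E \<sigma> w}" for w j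
    using bij_betwE[OF bij[of w]] that unfolding later_nbrs_def by blast
  have "w = u \<and> j = i"
    if "j \<in> {1..later_deg V E \<sigma> w}" "{u, later_nth V E \<sigma> u i} = {w, later_nth V E \<sigma> w j}" for w j
  proof -
    have "w = u"
      using lt[OF that(1)] lt[OF assms(4)] that(2) by (metis doubleton_eq_iff less_asym)
    then show ?thesis
      using bij[of u] that assms(4) unfolding bij_betw_def by (metis doubleton_eq_iff inj_on_def)
  qed
  then have "(THE f. \<exists>w \<in> V - K. \<exists>j \<in> {1..later_deg V E \<sigma> w}.
      {u, later_nth V E \<sigma> u i} = {w, later_nth V E \<sigma> w j} \<and> f = {w, x j}) = {u, x i}"
    using assms(3,4) by (intro the_equality) blast+
  then show ?thesis using assms(3) by (simp add: alpha_edge_def)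
qed

end

theory Submission
  imports Defs
begin

text \<open>
  If the later neighbours of every vertex form a clique, then sorting cliques by their first vertex
  shows that there are \<open>\<Sum>v. (later_deg v choose i)\<close> cliques with \<open>i + 1\<close> vertices. The graph \<open>T\<close> has
  exactly the edges \<open>{v, x i}\<close> with \<open>1 \<le> i \<le> later_deg v\<close>, for vertices \<open>v\<close> inside and outside \<open>K\<close>
  alike, because \<open>x j\<close> has the later neighbours \<open>x 1, \<dots>, x (j - 1)\<close>. So \<open>\<sigma>\<close> orders \<open>T\<close> in the same
  way and with the same later degrees, and the neighbourhoods are nested, which makes \<open>T\<close> a
  threshold graph.
\<close>

section \<open>Counting cliques by size from later degrees\<close>

lemma clique_insert_iff:
  "clique (insert v S) E \<longleftrightarrow> clique S E \<and> (\<forall>u\<in>S - {v}. {v, u} \<in> E)"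
  unfolding clique_def by (auto simp: insert_commute)

lemma inj_on_pos:
  assumes "bij_betw \<sigma> {1..card V} V"
  shows "inj_on (pos V \<sigma>) V"
  using assms unfolding pos_def bij_betw_def by (metis inj_on_inv_into subset_refl)

lemma mem_later_nbrs_iff:
  "u \<in> later_nbrs V E \<sigma> v \<longleftrightarrow> {v, u} \<in> E \<and> pos V \<sigma> v < pos V \<sigma> u"
  by (simp add: later_nbrs_def neighbours_def)

text \<open>The hypothesis is that later neighbourhoods are cliques, rather than \<open>PEO\<close>,
  so that the count applies verbatim to both G and T. A clique with \<open>i + 1\<close> vertices is
  its earliest vertex \<open>v\<close> together with an arbitrary \<open>i\<close>-subset of the
  later neighbours of \<open>v\<close>.\<close>

lemma card_cliques_Suc:
  assumes G: "simple_graph V E" and bij: "bij_betw \<sigma> {1..card V} V"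
    and cl: "\<And>v. v \<in> V \<Longrightarrow> clique (later_nbrs V E \<sigma> v) E"
  shows "card {C \<in> cliques V E. card C = Suc i} = (\<Sum>v\<in>V. later_deg V E \<sigma> v choose i)"
proof -
  let ?p = "pos V \<sigma>" and ?N = "later_nbrs V E \<sigma>"
  let ?S = "\<lambda>v. {S. S \<subseteq> ?N v \<and> card S = i}"
  have finV: "finite V" using G by (simp add: simple_graph_def)
  note N = later_nbrs_finite[OF G]
  have vN: "v \<notin> ?N v" for v by (simp add: mem_later_nbrs_iff)
  have "{C \<in> cliques V E. card C = Suc i} = (\<Union>v\<in>V. insert v ` ?S v)"
  proof (intro set_eqI iffI)
    fix C assume "C \<in> {C \<in> cliques V E. card C = Suc i}"
    then have C: "C \<subseteq> V" "clique C E" "card C = Suc i" by (auto simp: cliques_def)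
    then have fC: "finite C" "C \<noteq> {}" using card.infinite by fastforce+
    define v where "v = arg_min_on ?p C"
    have v: "v \<in> C" "\<And>u. u \<in> C \<Longrightarrow> ?p v \<le> ?p u"
      using arg_min_if_finite[OF fC, of ?p] unfolding v_def by (auto simp: not_less)
    have "C - {v} \<subseteq> ?N v"
    proof
      fix u assume u: "u \<in> C - {v}"
      then have "?p u \<noteq> ?p v"
        using inj_on_pos[OF bij] C(1) v(1) by (auto dest: inj_onD)
      then have "?p v < ?p u" using v(2)[of u] u by simp
      moreover have "{v, u} \<in> E" using C(2) u v(1) unfolding clique_def by auto
      ultimately show "u \<in> ?N v" by (simp add: mem_later_nbrs_iff)
    qed
    moreover have "card (C - {v}) = i" using C(3) v(1) by simp
    moreover have "C = insert v (C - {v})" using v(1) by blast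
    ultimately show "C \<in> (\<Union>v\<in>V. insert v ` ?S v)" using v(1) C(1) by blast
  next
    fix C assume "C \<in> (\<Union>v\<in>V. insert v ` ?S v)"
    then obtain v S where S: "v \<in> V" "C = insert v S" "S \<subseteq> ?N v" "card S = i" by blast
    have "finite S" "v \<notin> S" using S(3) N(1) vN by (auto intro: finite_subset)
    then have "card C = Suc i" using S by simp
    moreover have "C \<subseteq> V" using S N(2)[of \<sigma> v] by blast
    moreover have "clique S E" using cl[OF S(1)] S(3) unfolding clique_def by blast
    then have "clique C E"
      using S(3) unfolding S(2) clique_insert_iff by (auto simp: mem_later_nbrs_iff)
    ultimately show "C \<in> {C \<in> cliques V E. card C = Suc i}" by (simp add: cliques_def)
  qed
  also have "card \<dots> = (\<Sum>v\<in>V. card (insert v ` ?S v))"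
  proof (rule card_UN_disjoint[OF finV])
    show "\<forall>v\<in>V. finite (insert v ` ?S v)"
      using finite_Collect_subsets[OF N(1)] by simp
    show "\<forall>v\<in>V. \<forall>w\<in>V. v \<noteq> w \<longrightarrow> insert v ` ?S v \<inter> insert w ` ?S w = {}"
    proof (intro ballI impI equals0I)
      fix v w C assume "v \<noteq> w" "C \<in> insert v ` ?S v \<inter> insert w ` ?S w"
      then obtain S R where SR: "C = insert v S" "S \<subseteq> ?N v" "C = insert w R" "R \<subseteq> ?N w" by auto
      \<comment> \<open>If one clique arose from two different first vertices, each would be a later
        neighbour of the other.\<close>
      then have "w \<in> insert v S" "v \<in> insert w R" by (metis insertI1)+
      then have "w \<in> ?N v" "v \<in> ?N w" using SR(2,4) \<open>v \<noteq> w\<close> by auto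
      then show False by (simp add: mem_later_nbrs_iff)
    qed
  qed
  also have "\<dots> = (\<Sum>v\<in>V. later_deg V E \<sigma> v choose i)"
  proof (rule sum.cong[OF refl])
    fix v
    have "inj_on (insert v) (?S v)"
      using vN by (intro inj_onI) (metis (mono_tags, lifting) insert_ident mem_Collect_eq subsetD)
    then have "card (insert v ` ?S v) = card (?S v)" by (rule card_image)
    also have "\<dots> = later_deg V E \<sigma> v choose i"
      using n_subsets[OF N(1)] by (simp add: later_deg_def)
    finally show "card (insert v ` ?S v) = later_deg V E \<sigma> v choose i" .
  qed
  finally show ?thesis .
qed

section \<open>Clique vectors from clique counts\<close>

lemma finite_cliques: "finite V \<Longrightarrow> finite (cliques V E)"
  by (rule finite_subset[of _ "Pow V"]) (auto simp: cliques_def)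

lemma card_le_clique_number:
  assumes "finite V" "C \<in> cliques V E"
  shows "card C \<le> clique_number V E"
  using assms finite_cliques[of V E] by (simp add: clique_number_def)

text \<open>Equal counts also force equal clique numbers, hence vectors of equal length: a size
  occurs among the cliques iff its count is nonzero.\<close>

lemma clique_vector_cong:
  assumes fin: "finite V"
    and eq: "\<And>i. card {C \<in> cliques V E. card C = Suc i} = card {C \<in> cliques V F. card C = Suc i}"
  shows "clique_vector V E = clique_vector V F"
proof -
  \<comment> \<open>Size 0 is not covered by \<open>eq\<close>. Finiteness of \<open>V\<close>
    excludes infinite sets, whose \<open>card\<close> is also 0.\<close>
  have "{C \<in> cliques V D. card C = 0} = {{}}" for D :: "'a set set"
    using fin by (auto simp: cliques_def clique_def dest: finite_subset)
  then have eq': "card {C \<in> cliques V E. card C = i} = card {C \<in> cliques V F. card C = i}" for i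
    using eq by (cases i) auto
  have img: "card ` cliques V D = {i. card {C \<in> cliques V D. card C = i} \<noteq> 0}" for D :: "'a set set"
    using finite_cliques[OF fin, of D] by (auto simp: card_eq_0_iff)
  show ?thesis unfolding clique_vector_def clique_number_def img eq' ..
qed

section \<open>Threshold graphs from nested neighbourhoods\<close>

text \<open>\<open>A\<close> may meet \<open>V\<close>: each level added in the construction below
  contains an \<open>x\<close> vertex that is already present.\<close>

lemma threshold_graph_add_isolated:
  assumes "finite A" "threshold_graph V E"
  shows "threshold_graph (V \<union> A) E"
  using assms
proof (induction A)
  case (insert a A)
  then show ?case
    by (cases "a \<in> V \<union> A") (auto simp: insert_absorb intro: threshold_graph.isolated)
qed simp

text \<open>The graph is built by levels of \<open>r\<close>, from \<open>d - 1\<close> down to 0.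
  At level \<open>k\<close> the vertex \<open>x (Suc k)\<close> is added as a dominating vertex and
  the rest of the level as isolated vertices.\<close>

lemma threshold_graph_nested:
  fixes r :: "'a \<Rightarrow> nat"
  assumes fin: "finite V" and d: "0 < d" and r: "\<And>v. v \<in> V \<Longrightarrow> r v < d"
    and x: "\<And>i. i \<in> {1..d} \<Longrightarrow> x i \<in> V \<and> r (x i) = i - 1"
  shows "threshold_graph V {{v, x i} | v i. v \<in> V \<and> i \<in> {1..r v}}"
proof -
  \<comment> \<open>\<open>?W k\<close> and \<open>?F k\<close> are the vertices and edges present
    once level \<open>k\<close> is complete; at \<open>k = 0\<close> they are the whole
    graph.\<close>
  let ?W = "\<lambda>k. {v \<in> V. k \<le> r v}" and ?F = "\<lambda>k. {{v, x i} | v i. v \<in> V \<and> i \<in> {k<..r v}}"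
  have "0 \<le> d - 1" by simp
  then have "threshold_graph (?W 0) (?F 0)"
  proof (induction rule: inc_induct)
    case base
    \<comment> \<open>The top level has no edges, since \<open>r v < d\<close>; its member
      \<open>x d\<close> serves as the initial single vertex.\<close>
    have "threshold_graph ({x d} \<union> ?W (d - 1)) {}"
      using fin by (intro threshold_graph_add_isolated threshold_graph.single) simp
    moreover have "{x d} \<union> ?W (d - 1) = ?W (d - 1)" using x[of d] d by auto
    moreover have "?F (d - 1) = {}" using r by fastforce
    ultimately show ?case by (simp only:)
  next
    case (step k)
    then have xk: "x (Suc k) \<in> V" "r (x (Suc k)) = k" using x[of "Suc k"] by auto
    have "threshold_graph (insert (x (Suc k)) (?W (Suc k)))
        (?F (Suc k) \<union> {{x (Suc k), u} | u. u \<in> ?W (Suc k)})"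
      using step.IH xk by (intro threshold_graph.dominating) auto
    \<comment> \<open>The other vertices with \<open>r v = k\<close> are joined only to
      \<open>x 1, ..., x k\<close>, all of which lie on lower levels and are still to come.\<close>
    then have "threshold_graph (insert (x (Suc k)) (?W (Suc k)) \<union> {v \<in> V. r v = k})
        (?F (Suc k) \<union> {{x (Suc k), u} | u. u \<in> ?W (Suc k)})"
      using fin by (intro threshold_graph_add_isolated) auto
    moreover have "insert (x (Suc k)) (?W (Suc k)) \<union> {v \<in> V. r v = k} = ?W k"
      using xk by auto
    moreover have "?F (Suc k) \<union> {{x (Suc k), u} | u. u \<in> ?W (Suc k)} = ?F k"
    proof (intro set_eqI iffI)
      fix e assume "e \<in> ?F (Suc k) \<union> {{x (Suc k), u} | u. u \<in> ?W (Suc k)}"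
      then show "e \<in> ?F k"
      proof
        assume "e \<in> ?F (Suc k)"
        then obtain v i where "e = {v, x i}" "v \<in> V" "i \<in> {Suc k<..r v}" by blast
        then show ?thesis by (intro CollectI exI[of _ v] exI[of _ i]) simp
      next
        assume "e \<in> {{x (Suc k), u} | u. u \<in> ?W (Suc k)}"
        then obtain u where "e = {u, x (Suc k)}" "u \<in> V" "Suc k \<in> {k<..r u}"
          by (auto simp: insert_commute)
        then show ?thesis by blast
      qed
    next
      fix e assume "e \<in> ?F k"
      then obtain v i where e: "e = {v, x i}" "v \<in> V" "k < i" "i \<le> r v" by auto
      show "e \<in> ?F (Suc k) \<union> {{x (Suc k), u} | u. u \<in> ?W (Suc k)}"
      proof (cases "i = Suc k")
        case True
        then have "e = {x (Suc k), v}" "v \<in> ?W (Suc k)" using e by auto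
        then show ?thesis by blast
      next
        case False
        then have "i \<in> {Suc k<..r v}" using e by simp
        then show ?thesis using e by blast
      qed
    qed
    ultimately show ?case by (simp only:)
  qed
  moreover have "{0<..m} = {1..m}" for m :: nat by auto
  ultimately show ?thesis by simp
qed

section \<open>Later neighbourhoods in a perfect elimination ordering\<close>

lemma PEO_clique_later_nbrs:
  assumes G: "simple_graph V E" and "PEO V E \<sigma>" and "v \<in> V"
  shows "clique (later_nbrs V E \<sigma> v) E"
proof -
  have bij: "bij_betw \<sigma> {1..card V} V"
    and s: "\<And>i. i \<in> {1..card V} \<Longrightarrow> simplicial (induced_edges E (\<sigma> ` {i..card V})) (\<sigma> i)"
    using assms(2) by (auto simp: PEO_def)
  have p: "pos V \<sigma> u \<in> {1..card V}" "\<sigma> (pos V \<sigma> u) = u" if "u \<in> V" for u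
    using that bij unfolding pos_def bij_betw_def by (metis inv_into_into, metis f_inv_into_f)
  let ?D = "induced_edges E (\<sigma> ` {pos V \<sigma> v..card V})"
  have "clique (neighbours ?D v) ?D"
    using s[OF p(1)[OF \<open>v \<in> V\<close>]] p(2)[OF \<open>v \<in> V\<close>] by (simp add: simplicial_def)
  \<comment> \<open>Both \<open>v\<close> and a later neighbour lie in the final segment starting at
    \<open>v\<close>, so the edge between them survives in the induced subgraph.\<close>
  moreover have "later_nbrs V E \<sigma> v \<subseteq> neighbours ?D v"
  proof
    fix u assume u: "u \<in> later_nbrs V E \<sigma> v"
    then have uV: "u \<in> V" using later_nbrs_finite(2)[OF G] by blast
    have "w \<in> \<sigma> ` {pos V \<sigma> v..card V}" if "w \<in> {v, u}" for w
      using that u p[OF uV] p[OF \<open>v \<in> V\<close>]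
      by (intro image_eqI[of _ _ "pos V \<sigma> w"]) (auto simp: mem_later_nbrs_iff)
    then show "u \<in> neighbours ?D v"
      using u by (auto simp: neighbours_def induced_edges_def mem_later_nbrs_iff)
  qed
  ultimately show ?thesis by (auto simp: clique_def induced_edges_def)
qed

section \<open>The graph T and its comparison with G\<close>

theorem theorem5p5:
  fixes V :: "'a set" and E :: "'a set set" and K :: "'a set"
    and x :: "nat \<Rightarrow> 'a" and \<sigma> :: "nat \<Rightarrow> 'a" and n d :: nat
  assumes "simple_graph V E" and "chordal V E" and "\<not> complete_graph V E"
    and "card V = n" and "clique_number V E = d"
    and "maximum_clique V E K" and "bij_betw x {1..d} K"
    and "admissible V E K x \<sigma>"
  shows "threshold_graph V (alpha_edges V E K x \<sigma>) \<and>
    clique_vector V (alpha_edges V E K x \<sigma>) = clique_vector V E \<and>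
    b_vector V (alpha_edges V E K x \<sigma>) = b_vector V E"
proof -
  let ?p = "pos V \<sigma>" and ?N = "later_nbrs V E \<sigma>" and ?r = "later_deg V E \<sigma>"
  let ?T = "{{v, x i} | v i. v \<in> V \<and> i \<in> {1..?r v}}"
  note G = assms(1) and xK = assms(7)
  have fin: "finite V" and EV: "E \<subseteq> [V]\<^bsup>2\<^esup>" using G by (auto simp: simple_graph_def)
  have K: "K \<subseteq> V" "clique K E" "card K = d"
    using assms(5,6) by (auto simp: maximum_clique_def cliques_def)
  have peo: "PEO V E \<sigma>" and prec: "precedes V \<sigma> (V - K) K"
    and px: "\<And>i. i \<in> {1..d} \<Longrightarrow> ?p (x i) = card V - i + 1"
    using assms(8) K(3) by (auto simp: admissible_def)
  have bij: "bij_betw \<sigma> {1..card V} V" using peo by (simp add: PEO_def)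
  note clN = PEO_clique_later_nbrs[OF G peo]
  have dn: "d \<le> card V" using card_mono[OF fin K(1)] K(3) by simp
  have xin: "x i \<in> K" if "i \<in> {1..d}" for i using bij_betwE[OF xK] that by blast
  \<comment> \<open>The vertices of \<open>K\<close> are enumerated from the end of the ordering;
    \<open>dn\<close> keeps the natural subtraction in \<open>px\<close> from truncating.\<close>
  have pless: "?p (x j) < ?p (x i) \<longleftrightarrow> i < j" if "i \<in> {1..d}" "j \<in> {1..d}" for i j
    using px[OF that(1)] px[OF that(2)] that dn by auto
  have Kx: "\<exists>i\<in>{1..d}. v = x i" if "v \<in> K" for v
    using that xK unfolding bij_betw_def by blast
  have later_K: "u \<in> K" if "v \<in> K" "u \<in> V" "?p v < ?p u" for u v
    using prec that unfolding precedes_def by (meson DiffI less_asym)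
  \<comment> \<open>A vertex together with its later neighbours is a clique, so its size
    \<open>?r v + 1\<close> is at most the clique number.\<close>
  have rlt: "?r v < d" if "v \<in> V" for v
  proof -
    have "insert v (?N v) \<in> cliques V E"
      using clN[OF that] later_nbrs_finite(2)[OF G, of \<sigma> v] that
      by (auto simp: cliques_def clique_insert_iff mem_later_nbrs_iff)
    from card_le_clique_number[OF fin this] show ?thesis
      using later_nbrs_finite(1)[OF G, of \<sigma> v] assms(5)
      by (simp add: later_deg_def mem_later_nbrs_iff)
  qed
  have rx: "?r (x j) = j - 1" if j: "j \<in> {1..d}" for j
  proof -
    have "?N (x j) = x ` {1..<j}"
    proof (intro set_eqI iffI)
      fix u assume u: "u \<in> ?N (x j)"
      then have "u \<in> V" using later_nbrs_finite(2)[OF G] by blast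
      then have "u \<in> K" using later_K[OF xin[OF j]] u by (simp add: mem_later_nbrs_iff)
      then obtain i where "i \<in> {1..d}" "u = x i" using Kx by blast
      then show "u \<in> x ` {1..<j}" using u pless[of i j] j by (auto simp: mem_later_nbrs_iff)
    next
      fix u assume "u \<in> x ` {1..<j}"
      then obtain i where i: "u = x i" "i \<in> {1..d}" "i < j" using j by auto
      then have lt: "?p (x j) < ?p (x i)" using pless[of i j] j by simp
      then have "{x j, x i} \<in> E"
        using K(2) xin[OF j] xin[OF i(2)] unfolding clique_def by (metis less_irrefl)
      then show "u \<in> ?N (x j)" using lt i by (simp add: mem_later_nbrs_iff)
    qed
    moreover have "inj_on x {1..<j}"
      using xK j by (auto simp: bij_betw_def intro: inj_on_subset)
    ultimately show ?thesis by (simp add: later_deg_def card_image)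
  qed
  \<comment> \<open>The graph without vertices is complete, so non-completeness supplies a
    vertex.\<close>
  have "V \<noteq> {}"
    using assms(3) EV by (auto simp: complete_graph_def nsets_def)
  then have d: "0 < d" using rlt by fastforce
  \<comment> \<open>In every edge \<open>{v, x i}\<close> of \<open>?T\<close> the endpoint
    \<open>v\<close> is the earlier one; this fixes how an edge of \<open>?T\<close> is to be
    read.\<close>
  have TlessN: "?p v < ?p (x i)" if "v \<in> V" "i \<in> {1..?r v}" for v i
  proof (cases "v \<in> K")
    case True
    then obtain j where j: "j \<in> {1..d}" "v = x j" using Kx by blast
    then show ?thesis using rx[of j] pless[of i j] that by auto
  next
    case False
    have "x i \<in> K" using that rlt[of v] by (intro xin) auto
    then show ?thesis using False that(1) prec by (auto simp: precedes_def)
  qed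
  have xV: "x i \<in> V" if "v \<in> V" "i \<in> {1..?r v}" for v i
    using that rlt[of v] xin[of i] K(1) by auto
  have alpha: "alpha_edges V E K x \<sigma> = ?T"
  proof (intro set_eqI iffI)
    fix f assume "f \<in> alpha_edges V E K x \<sigma>"
    then obtain e where e: "e \<in> E" "f = alpha_edge V E K x \<sigma> e" by (auto simp: alpha_edges_def)
    then obtain a b where ab: "e = {a, b}" "a \<in> V" "b \<in> V" "a \<noteq> b"
      using EV by (auto simp: nsets_def card_2_iff)
    then have "?p a \<noteq> ?p b" using inj_on_pos[OF bij] by (auto dest: inj_onD)
    \<comment> \<open>The earlier endpoint \<open>v\<close> decides which clause of
      \<open>alpha_edge\<close> applies: if \<open>v\<close> is in \<open>K\<close>, then so is
      every later vertex, and the edge lies inside \<open>K\<close>.\<close>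
    then obtain v w where vw: "e = {v, w}" "v \<in> V" "w \<in> V" "?p v < ?p w"
      using ab by (metis insert_commute linorder_neqE_nat)
    then have w: "w \<in> ?N v" using e(1) by (simp add: mem_later_nbrs_iff)
    show "f \<in> ?T"
    proof (cases "v \<in> K")
      case True
      then have "w \<in> K" using later_K vw by blast
      then obtain i j where ij: "v = x j" "w = x i" "i \<in> {1..d}" "j \<in> {1..d}"
        using True Kx by metis
      then have "i \<in> {1..?r v}" using rx[of j] pless[of i j] vw(4) by auto
      moreover have "f = {v, x i}"
        using e(2) True \<open>w \<in> K\<close> vw(1) ij(2) by (simp add: alpha_edge_def)
      ultimately show ?thesis using vw(2) by blast
    next
      case False
      obtain i where i: "i \<in> {1..?r v}" "w = later_nth V E \<sigma> v i"
        using ex_later_nth[OF G bij w] by blast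
      then have "f = {v, x i}"
        using alpha_edge_outside[OF G bij, of v K i x] e(2) vw False by simp
      then show ?thesis using i(1) vw(2) by blast
    qed
  next
    fix f assume "f \<in> ?T"
    then obtain v i where f: "f = {v, x i}" "v \<in> V" "i \<in> {1..?r v}" by blast
    show "f \<in> alpha_edges V E K x \<sigma>"
    proof (cases "v \<in> K")
      case True
      have "x i \<in> K" using f rlt[of v] by (intro xin) auto
      then have "f \<in> E" "f \<subseteq> K"
        using True K(2) TlessN[OF f(2,3)] f(1) unfolding clique_def by (metis less_irrefl, simp)
      \<comment> \<open>Edges inside \<open>K\<close> are fixed, so \<open>f\<close> is its own
        preimage.\<close>
      then show ?thesis by (auto simp: alpha_edges_def alpha_edge_def intro!: image_eqI[of _ _ f])
    next
      case False
      have "later_nth V E \<sigma> v i \<in> ?N v"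
        using bij_betwE[OF later_nth_bij[OF G bij]] f(3) by blast
      then have "{v, later_nth V E \<sigma> v i} \<in> E" by (simp add: mem_later_nbrs_iff)
      then show ?thesis
        using alpha_edge_outside[OF G bij, of v K i x] f False
        unfolding alpha_edges_def by (metis DiffI image_eqI)
    qed
  qed
  have NT: "later_nbrs V ?T \<sigma> v = x ` {1..?r v}" if v: "v \<in> V" for v
  proof (intro set_eqI iffI)
    fix u assume u: "u \<in> later_nbrs V ?T \<sigma> v"
    then obtain w i where wi: "{v, u} = {w, x i}" "w \<in> V" "i \<in> {1..?r w}"
      by (auto simp: mem_later_nbrs_iff)
    have "?p v < ?p u" using u by (simp add: mem_later_nbrs_iff)
    \<comment> \<open>The swapped reading \<open>v = x i\<close>, \<open>u = w\<close> would reverse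
      the positions, against \<open>TlessN\<close>.\<close>
    then have "v = w \<and> u = x i"
      using wi(1) TlessN[OF wi(2,3)] by (metis doubleton_eq_iff less_asym)
    then show "u \<in> x ` {1..?r v}" using wi(3) by blast
  next
    fix u assume "u \<in> x ` {1..?r v}"
    then obtain i where i: "u = x i" "i \<in> {1..?r v}" by blast
    then have "{v, u} \<in> ?T" using v by blast
    then show "u \<in> later_nbrs V ?T \<sigma> v" using TlessN[OF v i(2)] i(1) by (simp only: mem_later_nbrs_iff)
  qed
  have rT: "later_deg V ?T \<sigma> v = ?r v" if v: "v \<in> V" for v
  proof -
    have "{1..?r v} \<subseteq> {1..d}" using rlt[OF v] by auto
    with xK have "inj_on x {1..?r v}" unfolding bij_betw_def by (metis inj_on_subset)
    then show ?thesis unfolding later_deg_def[of V ?T] NT[OF v] by (simp add: card_image)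
  qed
  have clT: "clique (later_nbrs V ?T \<sigma> v) ?T" if v: "v \<in> V" for v
    unfolding NT[OF v] clique_def
  proof (intro ballI impI)
    fix a b assume "a \<in> x ` {1..?r v}" "b \<in> x ` {1..?r v}" and ne: "a \<noteq> b"
    moreover have "{1..?r v} \<subseteq> {1..d}" using rlt[OF v] by auto
    ultimately obtain i j where ij: "a = x i" "b = x j" "i \<in> {1..d}" "j \<in> {1..d}" by blast
    \<comment> \<open>Later neighbours in \<open>?T\<close> are all among the \<open>x\<close>
      vertices, and \<open>K\<close> is still a clique in \<open>?T\<close>:
      \<open>?r (x k) = k - 1\<close> admits every index \<open>l < k\<close>.\<close>
    have *: "{x k, x l} \<in> ?T" if "l < k" "l \<in> {1..d}" "k \<in> {1..d}" for k l
    proof -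
      have "x k \<in> V" "l \<in> {1..?r (x k)}" using that rx[of k] xin[of k] K(1) by auto
      then show ?thesis by blast
    qed
    consider "i < j" | "j < i" using ne ij by (metis linorder_neqE_nat)
    then show "{a, b} \<in> ?T"
    proof cases
      case 1
      then show ?thesis using *[of i j] ij by (subst insert_commute) (simp only:)
    next
      case 2
      then show ?thesis using *[of j i] ij by (simp only:)
    qed
  qed
  have GT: "simple_graph V ?T"
    unfolding simple_graph_def
  proof (intro conjI fin subsetI)
    fix e assume "e \<in> ?T"
    then obtain v i where e: "e = {v, x i}" "v \<in> V" "i \<in> {1..?r v}" by blast
    then have "v \<noteq> x i" using TlessN[OF e(2,3)] by auto
    then show "e \<in> [V]\<^bsup>2\<^esup>" using e xV[OF e(2,3)] by (auto simp: nsets_def)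
  qed
  \<comment> \<open>By \<open>rT\<close> the two clique counts are the same sum of binomial
    coefficients.\<close>
  have cv: "clique_vector V ?T = clique_vector V E"
    by (rule clique_vector_cong[OF fin])
      (simp only: card_cliques_Suc[OF GT bij clT] card_cliques_Suc[OF G bij clN] rT cong: sum.cong)
  have "threshold_graph V ?T"
    using rx xin K(1) by (intro threshold_graph_nested[OF fin d rlt]) auto
  \<comment> \<open>The b-vector is defined from the clique vector alone, so its equality follows by
    unfolding.\<close>
  then show ?thesis using cv by (simp add: alpha b_vector_def)
qed

end
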